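(* For every integer $p\geq 0$, the sequences $\{|\Gamma_n^p|\}_{n\geq 0}$ and $\{|\Delta_n^p|\}_{n\geq 0}$, taken modulo $3$, are both periodic. Moreover, if $k\ge 0$ is an integer with $3^{k}+1\leq p\leq 3^{k+1}$, then $12\cdot 3^{k}$ is a period of both sequences modulo $3$.
   Context: The Cantor sequence $\mathbf{c}=(c_n)_{n\ge 0}\in\{0,1\}^{\mathbb{N}}$ is defined by $c_0=1$, $c_{3n}=c_n$, $c_{3n+1}=0$, $c_{3n+2}=c_n$ for $n\ge 0$. The sequence $\mathbf{d}=(d_n)_{n\geq 0}$ is defined by $d_n=c_n+c_{n+2}$. For $n\ge 1$, $p\ge 0$, let $\Gamma_n^p=(c_{p+i+j-2})_{1\le i,j\le n}$ and $\Delta_n^p=(d_{p+i+j-2})_{1\le i,j\le n}$, and let $|\Gamma_n^p|$, $|\Delta_n^p|$ be their determinants. For $n=0$ the following conventions are used: $|\Gamma_0^0|=2$, $|\Gamma_0^p|=1$ for $p\ge 1$, and $|\Delta_0^p|=1$ for $p\ge 0$. A sequence $(u_n)_{n\ge 0}$ is periodic of period $t\ge 1$ if $u_{n+t}=u_n$ for all $n\ge 0$ (equivalently, its generating series is $P(x)/(1-x^t)$ with $P$ a polynomial of degree less than $t$). *)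

theory Defs
  imports "Jordan_Normal_Form.Determinant"
begin

fun cantor :: "nat \<Rightarrow> int" where
  "cantor n = (if n = 0 then 1 else if n mod 3 = 1 then 0 else cantor (n div 3))"

declare cantor.simps [simp del]

lemma cantor_0: "cantor 0 = 1"
  by (simp add: cantor.simps)

lemma cantor_3n: "cantor (3 * n) = cantor n"
  by (cases "n = 0") (simp_all add: cantor.simps [of "3 * n"] cantor_0)

lemma cantor_3n1: "cantor (3 * n + 1) = 0"
proof -
  have "(3 * n + 1) mod 3 = 1" by presburger
  then show ?thesis by (subst cantor.simps) simp
qed

lemma cantor_3n2: "cantor (3 * n + 2) = cantor n"
proof -
  have "(3 * n + 2) mod 3 = 2" "(3 * n + 2) div 3 = n" by presburger+
  then show ?thesis by (subst cantor.simps) simp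
qed

definition cantor_d :: "nat \<Rightarrow> int" where
  "cantor_d n = cantor n + cantor (n + 2)"

(* Matrix indices start at 0, so the entry usually written u (p + i + j - 2)
   for 1 <= i, j <= n becomes u (p + i + j) for i, j < n. *)
definition hankel_mat :: "(nat \<Rightarrow> int) \<Rightarrow> nat \<Rightarrow> nat \<Rightarrow> int mat" where
  "hankel_mat u p n = mat n n (\<lambda>(i, j). u (p + i + j))"

(* By convention the determinant of order 0 is 2 for p = 0; for p >= 1 it is 1,
   which is the value of det on the empty matrix. *)
definition Gamma_det :: "nat \<Rightarrow> nat \<Rightarrow> int" where
  "Gamma_det p n = (if n = 0 \<and> p = 0 then 2 else det (hankel_mat cantor p n))"

definition Delta_det :: "nat \<Rightarrow> nat \<Rightarrow> int" where
  "Delta_det p n = det (hankel_mat cantor_d p n)"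

lemma Gamma_det_order_0: "Gamma_det 0 0 = 2" "p \<ge> 1 \<Longrightarrow> Gamma_det p 0 = 1"
  by (simp_all add: Gamma_det_def hankel_mat_def det_dim_zero)

lemma Delta_det_order_0: "Delta_det p 0 = 1"
  by (simp add: Delta_det_def hankel_mat_def det_dim_zero)

definition has_period :: "nat \<Rightarrow> (nat \<Rightarrow> 'a) \<Rightarrow> bool" where
  "has_period t u \<longleftrightarrow> t \<ge> 1 \<and> (\<forall>n. u (n + t) = u n)"

definition periodic :: "(nat \<Rightarrow> 'a) \<Rightarrow> bool" where
  "periodic u \<longleftrightarrow> (\<exists>t. has_period t u)"

end

theory Submission
  imports Defs "HOL-Computational_Algebra.Formal_Power_Series"
begin

text \<open>Over a ring of characteristic 3 the self-similarity of the Cantor sequence says that its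
  generating function satisfies \<open>f = (1 + X\<^sup>2) f\<^sup>3\<close>, so \<open>f = 1 / g\<close> with \<open>g\<^sup>2 = 1 + X\<^sup>2\<close>, and
  \<open>g = 1 + X\<^sup>2 d\<close> where \<open>d\<close> generates \<open>cantor_d\<close>. The roots \<open>2 - g\<close> and \<open>g - 1\<close> of
  \<open>T\<^sup>2 = T + X\<^sup>2\<close> show that the orthogonal polynomials of both sequences are Chebyshev-like: they obey
  \<open>P (n + 2) = X P (n + 1) + P n\<close>. A Christoffel-type identity expresses the \<open>n \<times> n\<close> Hankel
  determinant with shift \<open>p\<close> as a sign times the \<open>p \<times> p\<close> determinant of the coefficients of
  \<open>X\<^sup>0, \<dots>, X\<^sup>p\<^sup>-\<^sup>1\<close> in \<open>P n, \<dots>, P (n + p - 1)\<close>. Cubing the transfer matrix \<open>k\<close> times gives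
  \<open>P (n + 2 q) = X\<^sup>q P (n + q) + P n\<close> for \<open>q = 3\<^sup>k\<close> in characteristic 3, so these
  coefficients have period \<open>2 q\<close> in \<open>n\<close> as soon as \<open>p \<le> q\<close>; the sign has period dividing \<open>4 q\<close>.\<close>

section \<open>Hankel determinants and orthogonal polynomials\<close>

lemma det_hankel_orthogonal:
  fixes u :: "nat \<Rightarrow> 'a::idom" and P :: "nat \<Rightarrow> nat \<Rightarrow> 'a" and h :: "nat \<Rightarrow> 'a"
  assumes deg: "\<And>i j. i < j \<Longrightarrow> P i j = 0"
    and orth: "\<And>i r. r \<le> i \<Longrightarrow> (\<Sum>j\<le>i. P i j * u (r + j)) = (if r = i then h i else 0)"
  shows "det (mat n n (\<lambda>(i, j). u (p + i + j))) * (\<Prod>i<n + p. P i i) =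
    (-1) ^ (n * p) * (\<Prod>i<n. h i) * det (mat p p (\<lambda>(j, i). P (n + i) j))"
proof -
  let ?N = "n + p"
  \<comment> \<open>Padding the shifted Hankel matrix with unit rows lets a single column operation by the
    coefficients of the orthogonal polynomials turn it into a block triangular matrix.\<close>
  define M where "M = mat ?N ?N (\<lambda>(i, j). if i < p then if i = j then 1 else 0 else u (i - p + j))"
  define L where "L = mat ?N ?N (\<lambda>(j, i). P i j)"
  let ?H = "mat n n (\<lambda>(i, j). u (p + i + j))"
  let ?K = "mat p p (\<lambda>(j, i). P (n + i) j)"
  have long: "(\<Sum>j<?N. P i j * u (r + j)) = (\<Sum>j\<le>i. P i j * u (r + j))" if "i < ?N" for i r
    by (rule sum.mono_neutral_right) (use that deg in auto)
  have "M = four_block_mat (1\<^sub>m p) (0\<^sub>m p n) (mat n p (\<lambda>(i, j). u (i + j))) ?H"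
  proof (rule eq_matI)
    fix i j
    assume "i < dim_row (four_block_mat (1\<^sub>m p) (0\<^sub>m p n) (mat n p (\<lambda>(i, j). u (i + j))) ?H)"
      and "j < dim_col (four_block_mat (1\<^sub>m p) (0\<^sub>m p n) (mat n p (\<lambda>(i, j). u (i + j))) ?H)"
    then have "i < ?N" "j < ?N" by auto
    moreover have "p + (i - p) + (j - p) = i - p + j" if "\<not> i < p" "\<not> j < p"
      using that by simp
    ultimately show "M $$ (i, j) =
        four_block_mat (1\<^sub>m p) (0\<^sub>m p n) (mat n p (\<lambda>(i, j). u (i + j))) ?H $$ (i, j)"
      unfolding M_def by auto
  qed (auto simp: M_def)
  then have detM: "det M = det ?H"
    by (simp add: det_four_block_mat_upper_right_zero[of _ p _ n])
  have "det L = prod_list (diag_mat L)"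
    by (rule det_upper_triangular[of _ ?N]) (auto simp: L_def deg)
  also have "\<dots> = (\<Prod>i<?N. P i i)"
    by (simp add: diag_mat_def L_def prod.list_conv_set_nth atLeast0LessThan)
  finally have detL: "det L = (\<Prod>i<?N. P i i)" .
  have prod_nth: "(M * L) $$ (r, i) =
      (if r < p then P i r else \<Sum>j\<le>i. P i j * u (r - p + j))" if "r < ?N" "i < ?N" for r i
  proof -
    have "(M * L) $$ (r, i) = (\<Sum>j<?N. M $$ (r, j) * L $$ (j, i))"
      using that by (simp add: M_def L_def scalar_prod_def atLeast0LessThan)
    also have "\<dots> = (\<Sum>j<?N. if r < p then if j = r then P i j else 0 else P i j * u (r - p + j))"
      using that by (intro sum.cong) (auto simp: M_def L_def mult.commute)
    also have "\<dots> = (if r < p then P i r else \<Sum>j<?N. P i j * u (r - p + j))"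
      using that by simp
    finally show ?thesis by (simp only: long[OF that(2)])
  qed
  let ?T = "mat n n (\<lambda>(r, i). \<Sum>j\<le>i. P i j * u (r + j))"
  have c: "M * L \<in> carrier_mat (n + p) (n + p)"
    by (rule mult_carrier_mat[of _ _ ?N]) (simp_all add: M_def L_def)
  \<comment> \<open>Moving the \<open>p\<close> unit rows to the bottom gives the sign
    \<open>(-1) ^ (n * p)\<close>; the upper right block then vanishes by orthogonality.\<close>
  have "mat (n + p) (n + p) (\<lambda>(i, j). (M * L) $$ (if i < n then i + p else i - n, j)) =
      four_block_mat ?T (0\<^sub>m n p) (mat p n (\<lambda>(j, i). P i j)) ?K"
  proof (rule eq_matI)
    fix i j
    assume "i < dim_row (four_block_mat ?T (0\<^sub>m n p) (mat p n (\<lambda>(j, i). P i j)) ?K)"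
      and "j < dim_col (four_block_mat ?T (0\<^sub>m n p) (mat p n (\<lambda>(j, i). P i j)) ?K)"
    then have ij: "i < ?N" "j < ?N" by auto
    have "(\<Sum>l\<le>j. P j l * u (i + l)) = 0" if "i < n" "\<not> j < n"
      using that orth[of i j] by simp
    then show "mat ?N ?N (\<lambda>(i, j). (M * L) $$ (if i < n then i + p else i - n, j)) $$ (i, j) =
        four_block_mat ?T (0\<^sub>m n p) (mat p n (\<lambda>(j, i). P i j)) ?K $$ (i, j)"
      using ij by (auto simp: prod_nth)
  qed auto
  then have "det (M * L) = (-1) ^ (n * p) * (det ?T * det ?K)"
    unfolding det_swap_rows[OF c] by (simp add: det_four_block_mat_upper_right_zero[of _ n _ p])
  moreover have "det ?T = (\<Prod>i<n. h i)"
  proof -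
    have "det ?T = prod_list (diag_mat ?T)"
      by (rule det_lower_triangular[of n]) (auto simp: orth)
    also have "\<dots> = (\<Prod>i<n. h i)"
      by (simp add: diag_mat_def prod.list_conv_set_nth atLeast0LessThan orth)
    finally show ?thesis .
  qed
  moreover have "det (M * L) = det M * det L"
    by (rule det_mult[of _ ?N]) (auto simp: M_def L_def)
  ultimately show ?thesis by (simp add: detM detL ac_simps)
qed

section \<open>Chebyshev-like polynomials and their reversals\<close>

no_notation vec_index (infixl "$" 100)
unbundle fps_syntax

text \<open>Lucas polynomials for \<open>a = 2\<close>, Fibonacci polynomials (index shifted by one)
  for \<open>a = 1\<close>.\<close>

fun cheb :: "'a::comm_ring_1 \<Rightarrow> nat \<Rightarrow> 'a fps" where
  "cheb a 0 = fps_const a"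
| "cheb a (Suc 0) = fps_X"
| "cheb a (Suc (Suc n)) = fps_X * cheb a (Suc n) + cheb a n"

text \<open>\<open>rev_cheb a n\<close> is \<open>X\<^sup>n P (1 / X)\<close> for \<open>P = cheb a n\<close>; the parameter is \<open>a = 2\<close> for the
  first and \<open>a = 1\<close> for the second kind.\<close>

fun rev_cheb :: "'a::comm_ring_1 \<Rightarrow> nat \<Rightarrow> 'a fps" where
  "rev_cheb a 0 = fps_const a"
| "rev_cheb a (Suc 0) = 1"
| "rev_cheb a (Suc (Suc n)) = rev_cheb a (Suc n) + fps_X ^ 2 * rev_cheb a n"

lemma rev_cheb_nth_eq_0: "n < m \<Longrightarrow> rev_cheb a n $ m = 0"
  by (induction a n arbitrary: m rule: rev_cheb.induct) (auto simp: fps_X_power_mult_nth)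

lemma cheb_nth: "cheb a n $ j = (if j \<le> n then rev_cheb a n $ (n - j) else 0)"
proof (induction a n arbitrary: j rule: cheb.induct)
  case (3 a n)
  show ?case
  proof (cases j)
    case 0
    then show ?thesis
      using 3(2)[of 0] by (simp add: fps_X_power_mult_nth rev_cheb_nth_eq_0)
  next
    case (Suc i)
    have "rev_cheb a (Suc (Suc n)) $ (Suc n - i) =
        rev_cheb a (Suc n) $ (Suc n - i) + (if i < n then rev_cheb a n $ (n - Suc i) else 0)"
      by (auto simp: fps_X_power_mult_nth)
    moreover have "cheb a (Suc (Suc n)) $ Suc i = cheb a (Suc n) $ i + cheb a n $ Suc i"
      by simp
    ultimately show ?thesis
      unfolding Suc 3 by (auto simp: Suc_le_eq)
  qed
qed (auto simp: fps_X_def)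

lemma cheb_nth_diag: "cheb a n $ n = (if n = 0 then a else 1)"
  by (induction a n rule: cheb.induct) (auto simp: cheb_nth rev_cheb_nth_eq_0 fps_X_power_mult_nth)

text \<open>Reversing the polynomial turns correlation with \<open>u\<close> into
  convolution.\<close>

lemma sum_cheb_nth_mult:
  "(\<Sum>j\<le>n. cheb a n $ j * u (r + j)) = (rev_cheb a n * Abs_fps u) $ (n + r)"
proof -
  have "(rev_cheb a n * Abs_fps u) $ (n + r) = (\<Sum>i\<le>n + r. rev_cheb a n $ i * u (n + r - i))"
    by (simp add: fps_mult_nth atLeast0AtMost)
  also have "\<dots> = (\<Sum>i\<le>n. rev_cheb a n $ i * u (n + r - i))"
    by (rule sum.mono_neutral_right) (auto simp: rev_cheb_nth_eq_0)
  also have "\<dots> = (\<Sum>j\<le>n. rev_cheb a n $ (n - j) * u (n + r - (n - j)))"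
    by (rule sum.reindex_bij_witness[of _ "\<lambda>i. n - i" "\<lambda>i. n - i"]) auto
  also have "\<dots> = (\<Sum>j\<le>n. cheb a n $ j * u (r + j))"
    by (rule sum.cong) (auto simp: cheb_nth)
  finally show ?thesis ..
qed

lemma cheb_step:
  assumes three: "(3::'a::comm_ring_1) = 0"
  shows "cheb (a::'a) (n + 2 * 3 ^ k) = fps_X ^ 3 ^ k * cheb a (n + 3 ^ k) + cheb a n"
proof (induction k arbitrary: n)
  case (Suc k)
  define q :: nat where "q = 3 ^ k"
  define y :: "'a fps" where "y = fps_X ^ q"
  have three': "(3::'a fps) = 0"
    using three by (simp add: fps_eq_iff fps_numeral_nth)
  have step: "cheb a (m + 2 * q) = y * cheb a (m + q) + cheb a m" for m
    using Suc unfolding q_def y_def .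
  define C where "C = (\<lambda>i. cheb a (n + i * q))"
  have C: "C (Suc (Suc i)) = y * C (Suc i) + C i" for i
  proof -
    have "n + Suc (Suc i) * q = n + i * q + 2 * q" "n + Suc i * q = n + i * q + q" by simp_all
    then show ?thesis unfolding C_def by (simp only: step)
  qed
  \<comment> \<open>If a 2 by 2 matrix has trace \<open>y\<close> and determinant -1, its cube has
    trace \<open>y ^ 3 + 3 * y\<close> and determinant -1.\<close>
  have "C 6 = (y ^ 3 + 3 * y) * C 3 + C 0"
    by (simp add: C numeral_eq_Suc) (simp add: algebra_simps)
  then have "C 6 = y ^ 3 * C 3 + C 0" by (simp add: three')
  moreover have "(3::nat) ^ Suc k = q * 3" by (simp add: q_def)
  ultimately show ?case
    by (simp only: power_mult y_def[symmetric]) (simp add: C_def algebra_simps)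
qed simp

lemma cheb_nth_periodic:
  assumes "(3::'a::comm_ring_1) = 0" and "j < 3 ^ k"
  shows "cheb (a::'a) (n + 2 * 3 ^ k) $ j = cheb a n $ j"
  by (simp add: cheb_step[OF assms(1)] fps_X_power_mult_nth assms(2))

text \<open>Frobenius: cubing is additive, so splitting off the constant term reduces index
  \<open>n\<close> to \<open>n - 3\<close>.\<close>

lemma fps_cube_nth:
  fixes F :: "'a::comm_ring_1 fps"
  assumes three: "(3::'a) = 0"
  shows "(F ^ 3) $ n = (if 3 dvd n then (F $ (n div 3)) ^ 3 else 0)"
proof (induction n arbitrary: F rule: less_induct)
  case (less n)
  have three': "(3::'a fps) = 0"
    using three by (simp add: fps_eq_iff fps_numeral_nth)
  define c where "c = fps_const (F $ 0)"
  define G where "G = fps_shift 1 F"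
  have F: "F = c + fps_X * G"
    by (simp add: fps_eq_iff c_def G_def)
  have "F ^ 3 = c ^ 3 + fps_X ^ 3 * G ^ 3 + 3 * (c ^ 2 * fps_X * G + c * fps_X ^ 2 * G ^ 2)"
    unfolding F by (simp add: power3_eq_cube power2_eq_square algebra_simps)
  then have "F ^ 3 = fps_const ((F $ 0) ^ 3) + fps_X ^ 3 * G ^ 3"
    by (simp add: three' c_def fps_const_power)
  moreover have "(n - 3) div 3 = n div 3 - 1" "3 dvd n - 3 \<longleftrightarrow> 3 dvd n" "0 < n div 3" if "n \<ge> 3"
    using that by presburger+
  ultimately show ?case
    using less.IH[of "n - 3" G] by (auto simp: fps_X_power_mult_nth G_def dest: dvd_imp_le)
qed

text \<open>Binet formula: \<open>A\<close> and \<open>B\<close> are the roots of the characteristic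
  polynomial of the recurrence.\<close>

lemma rev_cheb_2_eq:
  assumes "A + B = 1" and "A * B = - (fps_X ^ 2)"
  shows "rev_cheb 2 n = A ^ n + B ^ n"
proof (induction "2::'a::comm_ring_1" n rule: rev_cheb.induct)
  case 1
  show ?case by (simp add: numeral_fps_const)
next
  case (3 n)
  have "A ^ Suc (Suc n) + B ^ Suc (Suc n) =
      (A + B) * (A ^ Suc n + B ^ Suc n) - (A * B) * (A ^ n + B ^ n)"
    by (simp add: algebra_simps)
  then show ?case using 3 by (simp add: assms)
qed (use assms in simp)

lemma rev_cheb_1_eq:
  assumes "A + B = 1" and "A * B = - (fps_X ^ 2)"
  shows "(A - B) * rev_cheb (1::'a::comm_ring_1) n = A ^ Suc n - B ^ Suc n"
proof (induction "1::'a" n rule: rev_cheb.induct)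
  case 2
  have "A ^ Suc (Suc 0) - B ^ Suc (Suc 0) = (A - B) * (A + B)"
    by (simp add: algebra_simps)
  then show ?case by (simp add: assms)
next
  case (3 n)
  have "A ^ Suc (Suc (Suc n)) - B ^ Suc (Suc (Suc n)) =
      (A + B) * (A ^ Suc (Suc n) - B ^ Suc (Suc n)) - (A * B) * (A ^ Suc n - B ^ Suc n)"
    by (simp add: algebra_simps)
  also have "\<dots> = (A - B) * rev_cheb 1 (Suc n) + fps_X ^ 2 * ((A - B) * rev_cheb 1 n)"
    unfolding 3 assms by simp
  finally show ?case by (simp add: algebra_simps)
qed simp

section \<open>The Cantor series in characteristic 3\<close>

definition cantor_fps :: "'a::comm_ring_1 fps" where
  "cantor_fps = Abs_fps (\<lambda>n. of_int (cantor n))"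

definition cantor_d_fps :: "'a::comm_ring_1 fps" where
  "cantor_d_fps = Abs_fps (\<lambda>n. of_int (cantor_d n))"

definition cantor_inv_fps :: "'a::comm_ring_1 fps" where
  "cantor_inv_fps = 1 + fps_X ^ 2 * cantor_d_fps"

lemma cantor_cases: "cantor n = 0 \<or> cantor n = 1"
  by (induction n rule: cantor.induct) (subst (1 2) cantor.simps, auto)

lemma cantor_1: "cantor 1 = 0"
  using cantor_3n1[of 0] by simp

lemma cantor_d_0: "cantor_d 0 = 2"
  using cantor_3n2[of 0] unfolding cantor_d_def mult_0_right add_0 cantor_0 by simp

lemma cantor_fps_nth_0: "cantor_fps $ 0 = 1"
  by (simp add: cantor_fps_def cantor_0)

lemma one_plus_X2_mult_cantor_fps:
  "(1 + fps_X ^ 2) * cantor_fps = 1 + fps_X ^ 2 * cantor_d_fps"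
proof (rule fps_ext)
  fix n :: nat
  have "n = 0 \<or> n = 1 \<or> n = n - 2 + 2" by linarith
  then consider "n = 0" | "n = 1" | m where "n = m + 2" by blast
  then show "((1 + fps_X ^ 2) * cantor_fps) $ n = (1 + fps_X ^ 2 * cantor_d_fps) $ n"
    using cantor_1
    by cases (simp_all add: distrib_right fps_X_power_mult_nth cantor_fps_def cantor_d_fps_def
      cantor_d_def cantor_0)
qed

context
  assumes three: "(3::'a::idom) = 0"
begin

private abbreviation (input) g :: "'a fps" where "g \<equiv> cantor_inv_fps"

lemma three_fps: "(3::'a fps) = 0"
  using three by (simp add: fps_eq_iff fps_numeral_nth)

text \<open>The coefficients are 0 or 1, so cubing only substitutes \<open>fps_X ^ 3\<close>; the
  factor \<open>1 + fps_X ^ 2\<close> then fills the residues 0 and 2 modulo 3.\<close>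

lemma cantor_fps_cube: "cantor_fps = (1 + fps_X ^ 2) * (cantor_fps :: 'a fps) ^ 3"
proof (rule fps_ext)
  fix n :: nat
  have cube: "(of_int (cantor m) :: 'a) ^ 3 = of_int (cantor m)" for m
    using cantor_cases[of m] by auto
  have "n = 3 * (n div 3) \<or> n = 3 * (n div 3) + 1 \<or> n = 3 * (n div 3) + 2" by presburger
  then consider m where "n = 3 * m" | m where "n = 3 * m + 1" | m where "n = 3 * m + 2" by blast
  then show "cantor_fps $ n = ((1 + fps_X ^ 2) * (cantor_fps :: 'a fps) ^ 3) $ n"
  proof cases
    case 1
    then have "\<not> 3 dvd n - 2 \<or> n < 2" by presburger
    then show ?thesis using 1
      by (auto simp: distrib_right fps_X_power_mult_nth fps_cube_nth[OF three] cantor_fps_def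
          cantor_3n cube)
  next
    case 2
    then have "\<not> 3 dvd n - 2 \<or> n < 2" "\<not> 3 dvd n" by presburger+
    then show ?thesis using 2 cantor_3n1[of m]
      by (auto simp: distrib_right fps_X_power_mult_nth fps_cube_nth[OF three] cantor_fps_def)
  next
    case 3
    then have "\<not> 3 dvd n" by presburger
    then show ?thesis using 3 cantor_3n2[of m]
      by (simp add: distrib_right fps_X_power_mult_nth fps_cube_nth[OF three] cantor_fps_def cube)
  qed
qed

lemma cantor_fps_mult_inv: "cantor_fps * g = 1"
proof -
  \<comment> \<open>Since \<open>g\<close> equals \<open>(1 + fps_X ^ 2) * cantor_fps\<close>, this
    is the cubic equation.\<close>
  have "cantor_fps * (cantor_fps * g) = cantor_fps * 1"
    using cantor_fps_cube unfolding cantor_inv_fps_def one_plus_X2_mult_cantor_fps[symmetric]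
    by (simp add: power3_eq_cube algebra_simps)
  moreover have "cantor_fps \<noteq> (0 :: 'a fps)"
    using cantor_fps_nth_0[where 'a = 'a] by auto
  ultimately show ?thesis by (metis mult_left_cancel)
qed

lemma cantor_inv_fps_squared: "g ^ 2 = 1 + fps_X ^ 2"
proof -
  have "g ^ 2 = (1 + fps_X ^ 2) * cantor_fps * g"
    by (simp only: power2_eq_square[of g] one_plus_X2_mult_cantor_fps
        cantor_inv_fps_def[symmetric])
  then show ?thesis by (simp add: mult.assoc cantor_fps_mult_inv)
qed

text \<open>The discriminant 1 + 4 X^2 equals \<open>g ^ 2\<close>, and 1/2 = -1, so the roots (1 +
  g)/2 and (1 - g)/2 become \<open>2 - g\<close> and \<open>g - 1\<close>.\<close>

lemma root_identities:
  "(2 - g) + (g - 1) = 1"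
  "(2 - g) * (g - 1) = - (fps_X ^ 2)"
  "(2 - g) - (g - 1) = g"
proof -
  have "(2 - g) * (g - 1) = - (g ^ 2) + 3 * g - 3 + 1"
    by (simp add: algebra_simps power2_eq_square)
  then show "(2 - g) * (g - 1) = - (fps_X ^ 2)" by (simp add: cantor_inv_fps_squared three_fps)
  have "(2 - g) - (g - 1) = g - 3 * g + 3" by (simp add: algebra_simps)
  then show "(2 - g) - (g - 1) = g" by (simp add: three_fps)
qed simp

lemma rev_cheb_2_closed: "rev_cheb 2 n = (2 - g) ^ n + (g - 1) ^ n"
  by (rule rev_cheb_2_eq) (rule root_identities)+

lemma rev_cheb_1_closed: "g * rev_cheb 1 n = (2 - g) ^ Suc n - (g - 1) ^ Suc n"
  using rev_cheb_1_eq[OF root_identities(1,2)] by (simp only: root_identities(3))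

section \<open>Orthogonality from the high order of vanishing of \<open>(g - 1) ^ n\<close>\<close>

lemma cantor_inv_fps_minus_1_power: "(g - 1) ^ n = fps_X ^ (2 * n) * cantor_d_fps ^ n"
  by (simp add: cantor_inv_fps_def power_mult_distrib power_mult)

lemma cantor_d_fps_power_nth_0: "(cantor_d_fps ^ n) $ 0 = (2 :: 'a) ^ n"
  by (simp add: fps_nth_power_0 cantor_d_fps_def cantor_d_0)

text \<open>The product \<open>rev_cheb 2 n * cantor_fps\<close> is a polynomial of degree below
  \<open>n\<close> plus a series starting at degree \<open>2 * n\<close>, so the coefficients in
  between vanish.\<close>

lemma orthogonal_cantor:
  assumes "r \<le> n"
  shows "(\<Sum>j\<le>n. cheb 2 n $ j * (of_int (cantor (r + j)) :: 'a)) = (if r = n then 2 ^ Suc n else 0)"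
proof -
  define W :: "'a fps" where "W = cantor_fps * ((2 - g) ^ n - (g - 1) ^ n)"
  have W: "W $ (n + r) = 0"
  proof (cases n)
    case (Suc k)
    have "W = (cantor_fps * g) * rev_cheb 1 k"
      by (simp only: W_def Suc rev_cheb_1_closed[symmetric] mult.assoc)
    then show ?thesis by (simp add: cantor_fps_mult_inv Suc rev_cheb_nth_eq_0)
  qed (simp add: W_def)
  have "rev_cheb 2 n * cantor_fps = W + 2 * (cantor_fps * (g - 1) ^ n)"
    by (simp add: rev_cheb_2_closed W_def algebra_simps)
  also have "\<dots> = W + fps_X ^ (2 * n) * (fps_const 2 * (cantor_fps * cantor_d_fps ^ n))"
    by (simp add: cantor_inv_fps_minus_1_power numeral_fps_const algebra_simps)
  finally have "(rev_cheb 2 n * cantor_fps) $ (n + r) = (if r = n then 2 ^ Suc n else (0 :: 'a))"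
    using assms
    by (auto simp: W fps_X_power_mult_nth cantor_d_fps_power_nth_0 cantor_fps_nth_0)
  then show ?thesis
    unfolding sum_cheb_nth_mult[where u = "\<lambda>n. of_int (cantor n)"] cantor_fps_def .
qed

lemma orthogonal_cantor_d:
  assumes "r \<le> n"
  shows "(\<Sum>j\<le>n. cheb 1 n $ j * (of_int (cantor_d (r + j)) :: 'a)) = (if r = n then 2 ^ Suc n else 0)"
proof -
  have "fps_X ^ 2 * (rev_cheb 1 n * cantor_d_fps) = g * rev_cheb 1 n - rev_cheb 1 n"
    by (simp add: cantor_inv_fps_def algebra_simps)
  also have "\<dots> = rev_cheb 2 (Suc n) - rev_cheb 1 n + (g - 1) ^ Suc n - 3 * (g - 1) ^ Suc n"
    unfolding rev_cheb_1_closed rev_cheb_2_closed by (simp only: algebra_simps) simp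
  also have "\<dots> = rev_cheb 2 (Suc n) - rev_cheb 1 n + fps_X ^ (2 * Suc n) * cantor_d_fps ^ Suc n"
    by (simp only: cantor_inv_fps_minus_1_power three_fps mult_zero_left diff_zero)
  \<comment> \<open>Both polynomial terms have degree at most \<open>n + 1\<close>, below
    \<open>n + r + 2\<close>.\<close>
  finally have "(fps_X ^ 2 * (rev_cheb 1 n * cantor_d_fps)) $ (n + r + 2) =
      (fps_X ^ (2 * Suc n) * cantor_d_fps ^ Suc n :: 'a fps) $ (n + r + 2)"
    by (simp add: rev_cheb_nth_eq_0)
  then have "(rev_cheb 1 n * cantor_d_fps) $ (n + r) =
      (fps_X ^ (2 * Suc n) * cantor_d_fps ^ Suc n :: 'a fps) $ (n + r + 2)"
    by (simp only: fps_X_power_mult_nth) simp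
  also have "\<dots> = (if r = n then 2 ^ Suc n else 0)"
    unfolding fps_X_power_mult_nth using assms cantor_d_fps_power_nth_0[of "Suc n"] by auto
  finally show ?thesis
    unfolding sum_cheb_nth_mult[where u = "\<lambda>n. of_int (cantor_d n)"] cantor_d_fps_def .
qed

end

section \<open>Reduction to determinants of fixed size\<close>

lemma of_int_det_hankel_mat:
  "of_int (det (hankel_mat u p n)) = det (mat n n (\<lambda>(i, j). of_int (u (p + i + j))))"
proof -
  have "map_mat of_int (hankel_mat u p n) = mat n n (\<lambda>(i, j). of_int (u (p + i + j)))"
    by (rule eq_matI) (auto simp: hankel_mat_def)
  then show ?thesis by (metis of_int_hom.hom_det)
qed

text \<open>The right side of \<open>det_hankel_orthogonal\<close> with
  \<open>h i = 2 ^ Suc i\<close>; the matrix size no longer depends on \<open>n\<close>.\<close>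

definition cheb_det :: "'a::comm_ring_1 \<Rightarrow> nat \<Rightarrow> nat \<Rightarrow> 'a" where
  "cheb_det a p n = (-1) ^ (n * p) * (\<Prod>i<n. 2 ^ Suc i) * det (mat p p (\<lambda>(j, i). cheb a (n + i) $ j))"

lemma det_mult_cheb_diag:
  fixes u :: "nat \<Rightarrow> 'a::idom"
  assumes "\<And>n r. r \<le> n \<Longrightarrow>
    (\<Sum>j\<le>n. cheb a n $ j * u (r + j)) = (if r = n then 2 ^ Suc n else 0)"
  shows "det (mat n n (\<lambda>(i, j). u (p + i + j))) * (if n + p = 0 then 1 else a) = cheb_det a p n"
proof -
  \<comment> \<open>All leading coefficients are 1 except possibly the one in degree 0, which is
    \<open>a\<close>.\<close>
  have "(\<Prod>i<n + p. cheb a i $ i) = (if n + p = 0 then 1 else a)"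
    by (cases "n + p") (simp_all add: cheb_nth_diag prod.lessThan_Suc_shift del: prod.lessThan_Suc)
  then show ?thesis
    using det_hankel_orthogonal[of "\<lambda>i j. cheb a i $ j" u "\<lambda>n. 2 ^ Suc n" n p] assms
    unfolding cheb_det_def by (simp add: cheb_nth)
qed

lemma of_int_Delta_det:
  assumes "(3::'a::idom) = 0"
  shows "of_int (Delta_det p n) = cheb_det (1::'a) p n"
  using det_mult_cheb_diag[OF orthogonal_cantor_d[OF assms]]
  by (simp add: Delta_det_def of_int_det_hankel_mat split: if_splits)

text \<open>The convention \<open>Gamma_det 0 0 = 2\<close> is what makes this formula uniform: the factor
  \<open>2\<close> contributed by the Chebyshev polynomial of degree \<open>0\<close> is present only when \<open>n + p > 0\<close>.\<close>

lemma of_int_Gamma_det: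
  assumes "(3::'a::idom) = 0"
  shows "of_int (Gamma_det p n) = 2 * cheb_det (2::'a) p n"
proof -
  let ?H = "mat n n (\<lambda>(i, j). of_int (cantor (p + i + j)) :: 'a)"
  \<comment> \<open>In characteristic 3 the factor 2 is its own inverse.\<close>
  have "2 * (det ?H * 2) = det ?H + 3 * det ?H" by simp
  then have "2 * (det ?H * 2) = det ?H" unfolding assms by simp
  moreover have "det ?H * (if n + p = 0 then 1 else 2) = cheb_det 2 p n"
    by (rule det_mult_cheb_diag[OF orthogonal_cantor[OF assms]])
  moreover have "of_int (Gamma_det p n) = det ?H" if "n + p \<noteq> 0"
    using that by (auto simp: Gamma_det_def of_int_det_hankel_mat)
  moreover have "of_int (Gamma_det p n) = 2 * cheb_det (2::'a) p n" if "n + p = 0"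
    using that by (simp add: Gamma_det_def cheb_det_def)
  ultimately show ?thesis by (cases "n + p = 0") (simp_all only: if_False simp_thms)
qed

section \<open>Periodicity and transfer to residues modulo 3\<close>

text \<open>With q = 3^(k+1), the coefficients have period 2q and the product of powers of 2 has
  period 4; as q is odd, their least common multiple is 4q, that is
  \<open>12 * 3 ^ k\<close>.\<close>

lemma cheb_det_periodic:
  assumes three: "(3::'a::comm_ring_1) = 0" and p: "p \<le> 3 ^ Suc k"
  shows "cheb_det (a::'a) p (n + 12 * 3 ^ k) = cheb_det a p n"
proof -
  have four: "(4::'a) = 1"
    using three by (metis add_0 numeral_plus_one semiring_norm(2) semiring_norm(8))
  have "(\<Prod>i<m + 4. (2::'a) ^ Suc i) = (\<Prod>i<m. 2 ^ Suc i)" for m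
  proof -
    \<comment> \<open>The four new exponents \<open>m + 1\<close> to \<open>m + 4\<close> sum to
      \<open>2 * (2 * m + 5)\<close>.\<close>
    have "(\<Prod>i<m + 4. (2::'a) ^ Suc i) = (\<Prod>i<m. 2 ^ Suc i) * (2 ^ 2) ^ (2 * m + 5)"
      unfolding power_mult[symmetric]
      by (simp add: numeral_eq_Suc power_add mult.assoc)
    then show ?thesis by (simp add: four)
  qed
  then have prod: "(\<Prod>i<n + 4 * m. (2::'a) ^ Suc i) = (\<Prod>i<n. 2 ^ Suc i)" for m
  proof (induction m)
    case (Suc m)
    then show ?case by (metis add.assoc mult_Suc_right add.commute)
  qed simp
  have "cheb a (n + 12 * 3 ^ k + i) $ j = cheb a (n + i) $ j" if "j < p" for i j
  proof -
    have j: "j < 3 ^ Suc k" using that p by simp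
    have "n + 12 * 3 ^ k + i = (n + i + 2 * 3 ^ Suc k) + 2 * 3 ^ Suc k" by simp
    then show ?thesis by (metis cheb_nth_periodic[OF three j])
  qed
  then have "mat p p (\<lambda>(j, i). cheb a (n + 12 * 3 ^ k + i) $ j) =
      mat p p (\<lambda>(j, i). cheb a (n + i) $ j)"
    by (intro eq_matI) auto
  moreover have "(-1::'a) ^ ((n + 12 * 3 ^ k) * p) = (-1) ^ (n * p)"
    by (simp add: distrib_right power_add power_mult)
  moreover have "(\<Prod>i<n + 12 * 3 ^ k. (2::'a) ^ Suc i) = (\<Prod>i<n. 2 ^ Suc i)"
    using prod[of "3 * 3 ^ k"] by simp
  ultimately show ?thesis by (simp only: cheb_det_def)
qed

text \<open>\<open>Enum.finite_3\<close> serves as a concrete field with three elements.\<close>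

lemma three_finite_3: "(3 :: Enum.finite_3) = 0"
proof -
  have "(3 :: Enum.finite_3) = 1 + 1 + 1" by (simp only: numeral_Bit1 numeral_One)
  also have "\<dots> = 0" by (simp only: one_finite_3_def plus_finite_3_def zero_finite_3_def) simp
  finally show ?thesis .
qed

lemma mod_3_eqI:
  assumes "(of_int a :: Enum.finite_3) = of_int b"
  shows "a mod 3 = b mod 3"
proof -
  have mod: "(of_int x :: Enum.finite_3) = of_int (x mod 3)" for x
  proof -
    have "(of_int x :: Enum.finite_3) = of_int (3 * (x div 3) + x mod 3)" by simp
    also have "\<dots> = of_int (x mod 3)"
      unfolding of_int_add of_int_mult by (simp add: three_finite_3)
    finally show ?thesis .
  qed
  have cases: "x mod 3 \<in> {0, 1, 2}" for x :: int by auto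
  have "of_int (a mod 3) = (of_int (b mod 3) :: Enum.finite_3)"
    using assms mod by metis
  moreover have "(2 :: Enum.finite_3) \<noteq> 0" "(2 :: Enum.finite_3) \<noteq> 1"
    unfolding one_add_one[symmetric] one_finite_3_def plus_finite_3_def zero_finite_3_def
    by simp_all
  ultimately show ?thesis using cases[of a] cases[of b] by auto
qed

lemma has_period_det_mod_3:
  assumes "p \<le> 3 ^ Suc k"
  shows "has_period (12 * 3 ^ k) (\<lambda>n. Gamma_det p n mod 3)"
    and "has_period (12 * 3 ^ k) (\<lambda>n. Delta_det p n mod 3)"
  using assms unfolding has_period_def
  by (auto intro!: mod_3_eqI simp: of_int_Gamma_det of_int_Delta_det three_finite_3
      cheb_det_periodic)

theorem theorem2:
  fixes p :: nat
  shows "(periodic (\<lambda>n. Gamma_det p n mod 3) \<and> periodic (\<lambda>n. Delta_det p n mod 3)) \<and>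
    (\<forall>k::nat. 3 ^ k + 1 \<le> p \<and> p \<le> 3 ^ (k + 1) \<longrightarrow>
      has_period (12 * 3 ^ k) (\<lambda>n. Gamma_det p n mod 3) \<and>
      has_period (12 * 3 ^ k) (\<lambda>n. Delta_det p n mod 3))"
proof -
  \<comment> \<open>For plain periodicity the witness is \<open>k = p\<close>.\<close>
  have "p < 3 ^ p" by (rule less_exp[THEN order.strict_trans2]) (simp add: power_mono)
  then have "p \<le> 3 ^ Suc p" by simp
  then show ?thesis
    unfolding periodic_def Suc_eq_plus1[symmetric] by (blast intro: has_period_det_mod_3)
qed

end
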